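(* Let $p$ be a prime and let $k = k_\ell p^\ell + k_{\ell-1} p^{\ell-1} + \cdots + k_1 p + k_0$ be the $p$-ary expansion of a non-negative integer $k$, with $k_i \in \{0,1,\ldots,p-1\}$. Then the $k$-th binomial sequence modulo $p$ is given by $$\left\{\binom{n}{k}\right\} = \left(\left\{\binom{n}{k_\ell}\right\} \otimes B_{p^\ell}\right) \odot \left(\left\{\binom{n}{k_{\ell-1}}\right\} \otimes B_{p^{\ell-1}}\right) \odot \cdots \odot \left(\left\{\binom{n}{k_1}\right\} \otimes B_{p}\right) \odot \left(\left\{\binom{n}{k_0}\right\} \otimes B_{p^0}\right).$$
   Context: For an integer $m\ge 0$, $\left\{\binom{n}{m}\right\}=\left\{\binom{n}{m}\right\}_{n\ge0}$ denotes the $m$-th ($p$-ary) binomial sequence, i.e. the sequence over $\mathbb{F}_p$ with $n$-th term $\binom{n}{m}\bmod p$ (and $\binom{n}{m}=0$ for $n<m$). The Hadamard product of sequences is termwise: $\{a_n\}\odot\{b_n\}=\{a_nb_n\}$. The Kronecker product of a sequence $\{a_n\}_{n\ge0}$ with a finite block $\{b_0,\ldots,b_m\}$ is the sequence $\{a_0b_0,a_0b_1,\ldots,a_0b_m,a_1b_0,\ldots,a_1b_m,a_2b_0,\ldots\}$. $B_{p^i}=\{1,1,\ldots,1\}$ is the block of $p^i$ ones; thus $\{a_n\}\otimes B_{p^i}$ repeats each term of $\{a_n\}$ consecutively $p^i$ times. *)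

theory Defs
  imports "HOL-Number_Theory.Residues"
begin

text \<open>
  The field with \<open>p\<close> elements is \<open>residue_ring (int p)\<close>, whose carrier is \<open>{0..int p - 1}\<close>.
  Sequences over a ring \<open>R\<close> are functions from \<open>nat\<close> with values in \<open>carrier R\<close>,
  finite blocks are lists over \<open>carrier R\<close>.
\<close>

definition binomial_seq :: "nat \<Rightarrow> nat \<Rightarrow> nat \<Rightarrow> int" where
  "binomial_seq p m = (\<lambda>n. int (n choose m) mod int p)"

definition hadamard :: "('a, 'b) monoid_scheme \<Rightarrow> (nat \<Rightarrow> 'a) \<Rightarrow> (nat \<Rightarrow> 'a) \<Rightarrow> nat \<Rightarrow> 'a" where
  "hadamard R a b = (\<lambda>n. a n \<otimes>\<^bsub>R\<^esub> b n)"

text \<open>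
  The term of index \<open>q * length b + r\<close> with \<open>r < length b\<close> is the product of \<open>a q\<close> and
  \<open>b ! r\<close>. Only nonempty blocks are meaningful.
\<close>

definition kronecker :: "('a, 'b) monoid_scheme \<Rightarrow> (nat \<Rightarrow> 'a) \<Rightarrow> 'a list \<Rightarrow> nat \<Rightarrow> 'a" where
  "kronecker R a b = (\<lambda>n. a (n div length b) \<otimes>\<^bsub>R\<^esub> b ! (n mod length b))"

definition ones_block :: "('a, 'b) monoid_scheme \<Rightarrow> nat \<Rightarrow> 'a list" where
  "ones_block R N = replicate N \<one>\<^bsub>R\<^esub>"

text \<open>
  \<open>hadamard_prod R S l\<close> is the Hadamard product of \<open>S l, S (l - 1), \<dots>, S 0\<close>, in this order.
\<close>

primrec hadamard_prod ::
    "('a, 'b) monoid_scheme \<Rightarrow> (nat \<Rightarrow> nat \<Rightarrow> 'a) \<Rightarrow> nat \<Rightarrow> nat \<Rightarrow> 'a" where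
  "hadamard_prod R S 0 = S 0"
| "hadamard_prod R S (Suc l) = hadamard R (S (Suc l)) (hadamard_prod R S l)"

end

theory Submission
  imports Defs
begin

text \<open>
  This is Lucas' theorem with the digits read off one at a time. For \<open>q = p ^ i\<close> the inner
  coefficients \<open>q choose j\<close> vanish modulo \<open>p\<close>, so Vandermonde's identity collapses to
  \<open>(m + q choose k) \<equiv> (m choose k) + (m choose k - q)\<close> for \<open>k \<ge> q\<close>: a Pascal rule with step \<open>q\<close>. Hence
  \<open>(n choose c * q + s) \<equiv> (n div q choose c) * (n mod q choose s)\<close> for \<open>s < q\<close>.
\<close>

text \<open>By absorption, \<open>j * (q choose j) = q * (q - 1 choose (j - 1))\<close> for
  \<open>q = p ^ i\<close>. If \<open>p\<close> did not divide the coefficient, all of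
  \<open>q\<close> would have to divide \<open>j\<close>, impossible for
  \<open>0 < j < q\<close>.\<close>

lemma prime_dvd_choose_prime_power:
  fixes p i j :: nat
  assumes "prime p" "0 < j" "j < p ^ i"
  shows "p dvd (p ^ i choose j)"
proof (rule ccontr)
  assume "\<not> p dvd (p ^ i choose j)"
  then have "coprime (p ^ i) (p ^ i choose j)"
    using assms(1) by (simp add: prime_imp_coprime)
  moreover have "p ^ i dvd j * (p ^ i choose j)"
    using assms times_binomial_minus1_eq[of j "p ^ i"] by simp
  ultimately have "p ^ i dvd j"
    by (simp add: coprime_dvd_mult_left_iff)
  then show False
    using assms(2,3) by (auto dest: dvd_imp_le)
qed

lemma choose_add_prime_power_cong:
  fixes p i m k :: nat
  assumes "prime p"
  shows "[(m + p ^ i choose k) =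
    (m choose k) + (if p ^ i \<le> k then (m choose (k - p ^ i)) else 0)] (mod p)"
proof -
  let ?q = "p ^ i"
  have q: "0 < ?q"
    using assms by (simp add: prime_gt_0_nat)
  have "(m + ?q choose k) = (\<Sum>j\<le>k. (?q choose j) * (m choose (k - j)))"
    by (simp add: vandermonde add.commute)
  \<comment> \<open>Only \<open>j = 0\<close> and \<open>j = ?q\<close> survive. Indicators let the
    sum be evaluated termwise; the second one never fires when \<open>?q > k\<close>.\<close>
  also have "[\<dots> = (\<Sum>j\<le>k. (if j = 0 then m choose k else 0)
      + (if j = ?q then m choose (k - ?q) else 0))] (mod p)"
  proof (rule cong_sum)
    fix j
    consider "j = 0" | "j = ?q" | "0 < j" "j < ?q" | "?q < j"
      by linarith
    then show "[(?q choose j) * (m choose (k - j)) = (if j = 0 then m choose k else 0)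
      + (if j = ?q then m choose (k - ?q) else 0)] (mod p)"
      using q prime_dvd_choose_prime_power[OF assms, of j i]
      by cases (auto simp: cong_0_iff binomial_eq_0 simp del: less_one)
  qed
  also have "(\<Sum>j\<le>k. (if j = 0 then m choose k else 0)
      + (if j = ?q then m choose (k - ?q) else 0))
    = (m choose k) + (if ?q \<le> k then (m choose (k - ?q)) else 0)"
    by (simp add: sum.distrib)
  finally show ?thesis .
qed

text \<open>Going from \<open>n\<close> to \<open>n + q\<close> with \<open>q = p ^ i\<close> raises
  the quotient by one and keeps the remainder, so both sides obey the same recurrence. It involves
  \<open>c\<close> and \<open>c - 1\<close>, hence the induction is over all
  \<open>c\<close>.\<close>

lemma choose_prime_power_div_mod_cong:
  fixes p i n c s :: nat
  assumes "prime p" "s < p ^ i"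
  shows "[(n choose (c * p ^ i + s)) = (n div p ^ i choose c) * (n mod p ^ i choose s)] (mod p)"
proof (induction n arbitrary: c rule: less_induct)
  case (less n)
  let ?q = "p ^ i"
  have q: "0 < ?q"
    using assms by linarith
  show ?case
  proof (cases "n < ?q")
    case True
    \<comment> \<open>The quotient is 0: for \<open>c = 0\<close> both sides agree, for
      \<open>c > 0\<close> both vanish since \<open>n < c * ?q\<close>.\<close>
    then show ?thesis
      by (cases c) (auto simp: binomial_eq_0)
  next
    case False
    define m where "m = n - ?q"
    have n: "n = m + ?q"
      using False by (simp add: m_def)
    then have "m < n"
      using q by linarith
    note IH = less.IH[OF \<open>m < n\<close>]
    have div: "n div ?q = Suc (m div ?q)" and mod: "n mod ?q = m mod ?q"
      using q by (simp_all add: n)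
    have pascal: "[(n choose (c * ?q + s)) = (m choose (c * ?q + s)) +
        (if ?q \<le> c * ?q + s then (m choose (c * ?q + s - ?q)) else 0)] (mod p)"
      unfolding n by (rule choose_add_prime_power_cong[OF assms(1)])
    show ?thesis
    proof (cases c)
      case 0
      \<comment> \<open>Here the lower index is \<open>s < ?q\<close>, so the shifted term of the
        Pascal rule is absent.\<close>
      then show ?thesis
        using cong_trans[OF pascal] IH[of 0] assms(2) by (simp add: mod)
    next
      case (Suc c')
      have "[(n choose (c * ?q + s)) =
          (m choose (c * ?q + s)) + (m choose (c' * ?q + s))] (mod p)"
        using pascal by (simp add: Suc)
      also have "[(m choose (c * ?q + s)) + (m choose (c' * ?q + s)) =
          (m div ?q choose c) * (m mod ?q choose s) +
          (m div ?q choose c') * (m mod ?q choose s)] (mod p)"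
        by (intro cong_add IH)
      \<comment> \<open>Ordinary Pascal for \<open>Suc (m div ?q) choose Suc c'\<close> merges the
        two products.\<close>
      finally show ?thesis
        by (simp add: div mod Suc algebra_simps)
    qed
  qed
qed

lemma sum_digits_less_power:
  fixes d :: "nat \<Rightarrow> nat"
  assumes "\<And>i. i < l \<Longrightarrow> d i < p"
  shows "(\<Sum>i<l. d i * p ^ i) < p ^ l"
  using assms
proof (induction l)
  case (Suc l)
  have "(\<Sum>i<Suc l. d i * p ^ i) < (d l + 1) * p ^ l"
    using Suc by simp
  also have "\<dots> \<le> p * p ^ l"
    using Suc.prems[of l] by (intro mult_right_mono) auto
  finally show ?case
    by simp
qed simp

text \<open>With \<open>0 < N\<close> the index \<open>n mod N\<close> lies inside the block, so the
  factor is one.\<close>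

lemma kronecker_binomial_seq_ones_block:
  assumes "0 < N"
  shows "kronecker (residue_ring (int p)) (binomial_seq p m)
      (ones_block (residue_ring (int p)) N) n = int (n div N choose m) mod int p"
  using assms by (simp add: kronecker_def binomial_seq_def ones_block_def residue_ring_def)

theorem theorem29:
  fixes p k l :: nat and d :: "nat \<Rightarrow> nat"
  assumes "prime p"
    and "k = (\<Sum>i\<le>l. d i * p ^ i)"
    and "\<forall>i\<le>l. d i \<in> {0..p - 1}"
  shows "binomial_seq p k =
    hadamard_prod (residue_ring (int p))
      (\<lambda>i. kronecker (residue_ring (int p)) (binomial_seq p (d i))
             (ones_block (residue_ring (int p)) (p ^ i))) l"
  using assms(2,3)
proof (induction l arbitrary: k)
  case 0
  then show ?case
    by (intro ext, subst hadamard_prod.simps, subst kronecker_binomial_seq_ones_block)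
      (simp_all add: binomial_seq_def)
next
  case (Suc l)
  let ?q = "p ^ Suc l" and ?k = "\<Sum>i\<le>l. d i * p ^ i"
  have p: "0 < p"
    using assms(1) by (simp add: prime_gt_0_nat)
  have "d i < p" if "i < Suc l" for i
    using Suc.prems(2)[rule_format, of i] that p by auto
  \<comment> \<open>This makes the value of the lower digits admissible as the remainder
    \<open>s\<close>.\<close>
  then have less: "?k < ?q"
    using sum_digits_less_power[of "Suc l" d p] by (simp only: lessThan_Suc_atMost)
  have k: "k = d (Suc l) * ?q + ?k"
    using Suc.prems(1) by simp
  have IH: "binomial_seq p ?k = hadamard_prod (residue_ring (int p))
      (\<lambda>i. kronecker (residue_ring (int p)) (binomial_seq p (d i))
             (ones_block (residue_ring (int p)) (p ^ i))) l"
    using Suc.prems(2) by (intro Suc.IH) auto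
  show ?case
  proof
    fix n
    have "[(n choose k) = (n div ?q choose d (Suc l)) * (n mod ?q choose ?k)] (mod p)"
      unfolding k by (rule choose_prime_power_div_mod_cong[OF assms(1) less])
    \<comment> \<open>The case \<open>c = 0\<close>, read backwards, restores \<open>n\<close> in
      place of \<open>n mod ?q\<close>, as the induction hypothesis concerns the sequence at
      \<open>n\<close> itself.\<close>
    also have "[(n div ?q choose d (Suc l)) * (n mod ?q choose ?k) =
        (n div ?q choose d (Suc l)) * (n choose ?k)] (mod p)"
      using choose_prime_power_div_mod_cong[OF assms(1) less, of n 0]
      by (intro cong_mult cong_refl) (simp add: cong_sym)
    finally have "int (n choose k) mod int p =
        int (n div ?q choose d (Suc l)) * int (n choose ?k) mod int p"
      by (simp add: cong_def flip: of_nat_mult of_nat_mod)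
    then show "binomial_seq p k n = hadamard_prod (residue_ring (int p))
        (\<lambda>i. kronecker (residue_ring (int p)) (binomial_seq p (d i))
               (ones_block (residue_ring (int p)) (p ^ i))) (Suc l) n"
      using p unfolding hadamard_prod.simps hadamard_def IH[symmetric]
      by (subst kronecker_binomial_seq_ones_block)
        (simp_all add: binomial_seq_def residue_ring_def mod_mult_eq)
  qed
qed

end
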